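(* Let $n\geq 2$ and let $Y$ be a graph with vertex set $[n]$. For each $[\alpha]_{\approx}\in\operatorname{Acyc}(\overline Y)/{\approx}$, choose a linear extension $\sigma_{[\alpha]_{\approx}}\in\mathcal L([\alpha]_{\approx})$, and let $H_{[\alpha]_{\approx}}$ be the connected component of $\mathsf{FS}(\mathsf{Cycle}_n,Y)$ containing $\sigma_{[\alpha]_{\approx}}$. Then the connected component $H_{[\alpha]_{\approx}}$ depends only on $[\alpha]_{\approx}$ (not on the specific choice of $\sigma_{[\alpha]_{\approx}}$), and its vertex set is $\mathcal L([\alpha]_{\approx})$. Moreover, \[\mathsf{FS}(\mathsf{Cycle}_n,Y)=\bigoplus_{[\alpha]_{\approx}\in\operatorname{Acyc}(\overline Y)/\approx}H_{[\alpha]_{\approx}},\] i.e., $\mathsf{FS}(\mathsf{Cycle}_n,Y)$ is the disjoint union of the subgraphs $H_{[\alpha]_{\approx}}$.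
   Context: All graphs are finite and simple; $[n]=\{1,\ldots,n\}$; $\overline Y$ is the complement of $Y$. For graphs $X,Y$ with $|V(X)|=|V(Y)|$, the friends-and-strangers graph $\mathsf{FS}(X,Y)$ has as vertices all bijections $\sigma\colon V(X)\to V(Y)$; two bijections $\sigma,\sigma'$ are adjacent iff there is an edge $\{a,b\}\in E(X)$ with $\{\sigma(a),\sigma(b)\}\in E(Y)$, $\sigma(a)=\sigma'(b)$, $\sigma(b)=\sigma'(a)$, and $\sigma(c)=\sigma'(c)$ for all $c\in V(X)\setminus\{a,b\}$. When $V(X)=V(Y)=[n]$, the vertices are the permutations in $\mathfrak S_n$. $\mathsf{Cycle}_n$ is the graph with vertex set $[n]$ and edge set $\{\{i,i+1\}:1\le i\le n-1\}\cup\{\{n,1\}\}$. For a graph $G$ with vertex set $[n]$, $\operatorname{Acyc}(G)$ is the set of acyclic orientations of $G$. For $\alpha\in\operatorname{Acyc}(G)$, $\leq_\alpha$ is the partial order on $[n]$ with $i\leq_\alpha j$ iff $\alpha$ contains a directed path (possibly of length $0$) from $i$ to $j$. $\mathcal L(\alpha)$ is the set of linear extensions of $([n],\leq_\alpha)$, i.e., permutations $\sigma\in\mathfrak S_n$ such that $\sigma^{-1}(a)\leq\sigma^{-1}(b)$ whenever $a\leq_\alpha b$. A source (sink) of $\alpha$ is a vertex of in-degree (out-degree) $0$. If $\alpha$ has a source $u$ and a sink $v$ that are not adjacent in $G$, a double flip simultaneously flips $u$ into a sink and $v$ into a source, i.e., reverses all edges incident to $u$ or to $v$. Write $\alpha\approx\alpha'$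 (double-flip equivalence) if $\alpha'$ can be obtained from $\alpha$ by a sequence of double flips; $[\alpha]_\approx$ is the equivalence class of $\alpha$. Set $\mathcal L([\alpha]_\approx)=\bigcup_{\widehat\alpha\in[\alpha]_\approx}\mathcal L(\widehat\alpha)$; its elements are called linear extensions of $[\alpha]_\approx$. *)

theory Defs
  imports "Graph_Theory.Graph_Theory" "HOL-Library.FuncSet" "HOL-Library.Disjoint_Sets"
begin

text \<open>
  As in the session Graph_Theory, a finite simple graph is a symmetric loop-free finite digraph
  (locale \<open>pair_graph\<close>): an edge \<open>{u, v}\<close> is the pair of arcs \<open>(u, v)\<close> and \<open>(v, u)\<close>.
\<close>

definition complement_graph :: "'a pair_pre_digraph \<Rightarrow> 'a pair_pre_digraph" where
  "complement_graph G =
     \<lparr> pverts = pverts G,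
       parcs = {(u, v). u \<in> pverts G \<and> v \<in> pverts G \<and> u \<noteq> v \<and> (u, v) \<notin> parcs G} \<rparr>"

text \<open>For \<open>n = 1\<close> this has a loop at \<open>1\<close>; it is only used for \<open>n \<ge> 2\<close>.\<close>

definition cycle_graph :: "nat \<Rightarrow> nat pair_pre_digraph" where
  "cycle_graph n =
     (let E = {(i, i + 1) | i. 1 \<le> i \<and> i \<le> n - 1} \<union> {(n, 1)}
      in \<lparr> pverts = {1..n}, parcs = E \<union> E\<inverse> \<rparr>)"


subsection \<open>Friends-and-strangers graphs\<close>

text \<open>Bijections are extensional functions, so that each one is represented exactly once.\<close>

definition bijections :: "'a set \<Rightarrow> 'b set \<Rightarrow> ('a \<Rightarrow> 'b) set" where
  "bijections A B = {\<sigma> \<in> extensional A. bij_betw \<sigma> A B}"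

definition FS :: "'a pair_pre_digraph \<Rightarrow> 'b pair_pre_digraph \<Rightarrow> ('a \<Rightarrow> 'b) pair_pre_digraph" where
  "FS X Y =
     \<lparr> pverts = bijections (pverts X) (pverts Y),
       parcs = {(\<sigma>, \<sigma>'). \<sigma> \<in> bijections (pverts X) (pverts Y) \<and> \<sigma>' \<in> bijections (pverts X) (pverts Y) \<and>
         (\<exists>a b. (a, b) \<in> parcs X \<and> (\<sigma> a, \<sigma> b) \<in> parcs Y \<and> \<sigma> a = \<sigma>' b \<and> \<sigma> b = \<sigma>' a \<and>
                (\<forall>c \<in> pverts X - {a, b}. \<sigma> c = \<sigma>' c))} \<rparr>"


subsection \<open>Connected components and disjoint unions\<close>

text \<open>
  Meant for symmetric \<open>G\<close>, where the components are the elements of \<open>pre_digraph.sccs\<close>;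
  see \<open>component_of_in_sccs\<close> below.
\<close>

definition component_of :: "'a pair_pre_digraph \<Rightarrow> 'a \<Rightarrow> ('a, 'a \<times> 'a) pre_digraph" where
  "component_of G u = with_proj G \<restriction> {v. u \<rightarrow>\<^sup>*\<^bsub>with_proj G\<^esub> v}"

definition is_disjoint_union ::
    "('a, 'b) pre_digraph \<Rightarrow> 'i set \<Rightarrow> ('i \<Rightarrow> ('a, 'b) pre_digraph) \<Rightarrow> bool" where
  "is_disjoint_union G I H \<longleftrightarrow>
     (\<forall>i \<in> I. subgraph (H i) G) \<and>
     disjoint_family_on (\<lambda>i. verts (H i)) I \<and>
     verts G = (\<Union>i \<in> I. verts (H i)) \<and>
     arcs G = (\<Union>i \<in> I. arcs (H i))"


subsection \<open>Acyclic orientations and double flips\<close>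

text \<open>An orientation is the set of its arcs; its vertex set is that of the graph.\<close>

definition orientation :: "'a pair_pre_digraph \<Rightarrow> ('a \<times> 'a) set \<Rightarrow> bool" where
  "orientation G \<alpha> \<longleftrightarrow> \<alpha> \<union> \<alpha>\<inverse> = parcs G \<and> \<alpha> \<inter> \<alpha>\<inverse> = {}"

definition Acyc :: "'a pair_pre_digraph \<Rightarrow> ('a \<times> 'a) set set" where
  "Acyc G = {\<alpha>. orientation G \<alpha> \<and> acyclic \<alpha>}"

definition is_source :: "('a \<times> 'a) set \<Rightarrow> 'a \<Rightarrow> bool" where
  "is_source \<alpha> u \<longleftrightarrow> (\<forall>x. (x, u) \<notin> \<alpha>)"

definition is_sink :: "('a \<times> 'a) set \<Rightarrow> 'a \<Rightarrow> bool" where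
  "is_sink \<alpha> v \<longleftrightarrow> (\<forall>x. (v, x) \<notin> \<alpha>)"

definition reverse_at :: "'a set \<Rightarrow> ('a \<times> 'a) set \<Rightarrow> ('a \<times> 'a) set" where
  "reverse_at S \<alpha> = {(i, j) \<in> \<alpha>. i \<notin> S \<and> j \<notin> S} \<union> {(j, i) | i j. (i, j) \<in> \<alpha> \<and> (i \<in> S \<or> j \<in> S)}"

text \<open>The case \<open>u = v\<close> forces \<open>u\<close> to be isolated, and then nothing is reversed.\<close>

definition double_flip :: "'a pair_pre_digraph \<Rightarrow> ('a \<times> 'a) set \<Rightarrow> ('a \<times> 'a) set \<Rightarrow> bool" where
  "double_flip G \<alpha> \<alpha>' \<longleftrightarrow>
     (\<exists>u \<in> pverts G. \<exists>v \<in> pverts G.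
        is_source \<alpha> u \<and> is_sink \<alpha> v \<and> (u, v) \<notin> parcs G \<and> \<alpha>' = reverse_at {u, v} \<alpha>)"

definition double_flip_equiv :: "'a pair_pre_digraph \<Rightarrow> (('a \<times> 'a) set \<times> ('a \<times> 'a) set) set" where
  "double_flip_equiv G = {(\<alpha>, \<alpha>'). \<alpha> \<in> Acyc G \<and> (double_flip G)\<^sup>*\<^sup>* \<alpha> \<alpha>'}"

definition double_flip_classes :: "'a pair_pre_digraph \<Rightarrow> ('a \<times> 'a) set set set" where
  "double_flip_classes G = Acyc G // double_flip_equiv G"


subsection \<open>Linear extensions\<close>

definition orientation_le :: "'a set \<Rightarrow> ('a \<times> 'a) set \<Rightarrow> 'a \<Rightarrow> 'a \<Rightarrow> bool" where
  "orientation_le V \<alpha> i j \<longleftrightarrow> i \<in> V \<and> j \<in> V \<and> (i, j) \<in> \<alpha>\<^sup>*"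

definition linear_extensions :: "nat \<Rightarrow> (nat \<times> nat) set \<Rightarrow> (nat \<Rightarrow> nat) set" where
  "linear_extensions n \<alpha> =
     {\<sigma> \<in> bijections {1..n} {1..n}.
        \<forall>a b. orientation_le {1..n} \<alpha> a b \<longrightarrow> inv_into {1..n} \<sigma> a \<le> inv_into {1..n} \<sigma> b}"

definition class_linear_extensions :: "nat \<Rightarrow> (nat \<times> nat) set set \<Rightarrow> (nat \<Rightarrow> nat) set" where
  "class_linear_extensions n A = (\<Union>\<alpha> \<in> A. linear_extensions n \<alpha>)"


subsection \<open>Sanity checks\<close>

lemma pair_graph_complement_graph:
  assumes "pair_graph G"
  shows "pair_graph (complement_graph G)"
proof -
  interpret pair_graph G by fact
  have "parcs (complement_graph G) \<subseteq> pverts G \<times> pverts G"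
    by (auto simp: complement_graph_def)
  then have "finite (parcs (complement_graph G))"
    by (rule finite_subset) simp
  then show ?thesis
    by unfold_locales
      (auto simp: complement_graph_def symmetric_def intro!: symI dest: arcs_symmetric)
qed

lemma pair_graph_cycle_graph:
  assumes "n \<ge> 2"
  shows "pair_graph (cycle_graph n)"
proof -
  have "parcs (cycle_graph n) \<subseteq> {1..n} \<times> {1..n}"
    using assms by (auto simp: cycle_graph_def)
  then have "finite (parcs (cycle_graph n))"
    by (rule finite_subset) simp
  then show ?thesis
    using assms
    by unfold_locales (auto simp: cycle_graph_def symmetric_def Let_def intro!: symI)
qed

lemma pair_graph_FS:
  assumes "pair_graph X" "pair_graph Y"
  shows "pair_graph (FS X Y)"
proof -
  interpret X: pair_graph X by fact
  interpret Y: pair_graph Y by fact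
  have "bijections (pverts X) (pverts Y) \<subseteq> pverts X \<rightarrow>\<^sub>E pverts Y"
    by (auto simp: bijections_def PiE_def bij_betw_def)
  then have fin: "finite (bijections (pverts X) (pverts Y))"
    by (rule finite_subset) (simp add: finite_PiE)
  have "parcs (FS X Y) \<subseteq> bijections (pverts X) (pverts Y) \<times> bijections (pverts X) (pverts Y)"
    by (auto simp: FS_def)
  then have fin': "finite (parcs (FS X Y))"
    by (rule finite_subset) (simp add: fin)
  have "sym (parcs (FS X Y))"
  proof (rule symI)
    fix \<sigma> \<tau> assume *: "(\<sigma>, \<tau>) \<in> parcs (FS X Y)"
    then obtain a b where ab: "(a, b) \<in> parcs X" "(\<sigma> a, \<sigma> b) \<in> parcs Y" "\<sigma> a = \<tau> b" "\<sigma> b = \<tau> a"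
      "\<forall>c \<in> pverts X - {a, b}. \<sigma> c = \<tau> c"
      by (auto simp: FS_def)
    have "(\<tau> a, \<tau> b) \<in> parcs Y"
      using ab Y.arcs_symmetric by metis
    moreover have "\<forall>c \<in> pverts X - {a, b}. \<tau> c = \<sigma> c"
      using ab(5) by simp
    ultimately have "\<exists>a b. (a, b) \<in> parcs X \<and> (\<tau> a, \<tau> b) \<in> parcs Y \<and> \<tau> a = \<sigma> b \<and> \<tau> b = \<sigma> a \<and>
        (\<forall>c \<in> pverts X - {a, b}. \<tau> c = \<sigma> c)"
      using ab(1) ab(3,4)[symmetric] by blast
    with * show "(\<tau>, \<sigma>) \<in> parcs (FS X Y)"
      by (simp add: FS_def)
  qed
  moreover have "fst e \<noteq> snd e" if "e \<in> parcs (FS X Y)" for e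
    using that Y.no_loops' by (auto simp: FS_def dest: X.no_loops' Y.no_loops')
  moreover have "pverts (FS X Y) = bijections (pverts X) (pverts Y)"
    by (simp add: FS_def)
  moreover have "fst e \<in> bijections (pverts X) (pverts Y) \<and> snd e \<in> bijections (pverts X) (pverts Y)"
    if "e \<in> parcs (FS X Y)" for e
    using that by (auto simp: FS_def)
  ultimately show ?thesis
    using fin fin' by unfold_locales (simp_all add: symmetric_def)
qed

lemma component_of_in_sccs:
  assumes "pair_graph G" "u \<in> pverts G"
  shows "component_of G u \<in> pre_digraph.sccs (with_proj G)" "u \<in> verts (component_of G u)"
proof -
  interpret pair_graph G by fact
  show "u \<in> verts (component_of G u)"
    using assms by (simp add: component_of_def)
  have "{v. u \<rightarrow>\<^sup>*\<^bsub>with_proj G\<^esub> v} = scc_of u"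
    unfolding scc_of_def using symmetric_reachable[OF sym_arcs] by blast
  then have "{v. u \<rightarrow>\<^sup>*\<^bsub>with_proj G\<^esub> v} \<in> sccs_verts"
    using scc_of_in_sccs_verts assms(2) by simp
  then show "component_of G u \<in> sccs"
    unfolding component_of_def in_sccs_verts_conv by simp
qed

lemma reverse_at_conv: "(i, j) \<in> reverse_at S \<alpha> \<longleftrightarrow>
    (if i \<in> S \<or> j \<in> S then (j, i) \<in> \<alpha> else (i, j) \<in> \<alpha>)"
  by (auto simp: reverse_at_def)

lemma double_flip_Acyc:
  assumes G: "pair_graph G" and "\<alpha> \<in> Acyc G" "double_flip G \<alpha> \<beta>"
  shows "\<beta> \<in> Acyc G" "double_flip G \<beta> \<alpha>"
proof -
  interpret pair_graph G by fact
  from assms obtain u v where uv: "u \<in> pverts G" "v \<in> pverts G" "is_source \<alpha> u" "is_sink \<alpha> v"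
    "(u, v) \<notin> parcs G" and \<beta>: "\<beta> = reverse_at {u, v} \<alpha>"
    by (auto simp: double_flip_def)
  have \<alpha>: "\<alpha> \<union> \<alpha>\<inverse> = parcs G" "\<alpha> \<inter> \<alpha>\<inverse> = {}" "acyclic \<alpha>"
    using assms by (auto simp: Acyc_def orientation_def)
  have nadj: "(u, v) \<notin> \<alpha>" "(v, u) \<notin> \<alpha>"
    using uv(5) \<alpha>(1) by auto
  have arcs_iff: "(i, j) \<in> parcs G \<longleftrightarrow> (i, j) \<in> \<alpha> \<or> (j, i) \<in> \<alpha>" for i j
    using \<alpha>(1) by auto
  have one: "(i, j) \<in> \<alpha> \<Longrightarrow> (j, i) \<notin> \<alpha>" for i j
    using \<alpha>(2) by auto
  have or: "orientation G \<beta>"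
    unfolding orientation_def set_eq_iff split_paired_All
    by (auto simp: \<beta> reverse_at_conv arcs_iff dest: one)
  have u: "(u, x) \<notin> \<beta>" and v: "(x, v) \<notin> \<beta>" for x
    using uv by (auto simp: \<beta> reverse_at_conv is_source_def is_sink_def)
  have "(x, y) \<in> \<alpha>\<^sup>+" if "(x, y) \<in> \<beta>\<^sup>+" "x \<noteq> v" "y \<noteq> u" for x y
    using that
  proof (induction rule: trancl_induct)
    case (base y)
    then show ?case
      using u v by (cases "x = u \<or> y = v") (auto simp: \<beta> reverse_at_conv)
  next
    case (step y z)
    have "y \<noteq> u" "z \<noteq> v" using step u v by auto
    moreover have "y \<noteq> v" using step(1) v by (auto dest: tranclD2)
    ultimately have "(y, z) \<in> \<alpha>"
      using step by (auto simp: \<beta> reverse_at_conv)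
    then show ?case
      using step \<open>y \<noteq> u\<close> by auto
  qed
  moreover have "x \<noteq> u \<and> x \<noteq> v" if "(x, x) \<in> \<beta>\<^sup>+" for x
    using that u v by (blast dest: tranclD tranclD2)
  ultimately have "acyclic \<beta>"
    using \<alpha>(3) unfolding acyclic_def by blast
  with or show "\<beta> \<in> Acyc G" by (simp add: Acyc_def)
  have "reverse_at {v, u} \<beta> = \<alpha>"
    unfolding set_eq_iff split_paired_All by (auto simp: \<beta> reverse_at_conv)
  moreover have "(v, u) \<notin> parcs G"
    using uv(5) arcs_symmetric by auto
  moreover have "is_source \<beta> v" "is_sink \<beta> u"
    using u v by (auto simp: is_source_def is_sink_def)
  ultimately show "double_flip G \<beta> \<alpha>"
    using uv(1,2) unfolding double_flip_def by metis
qed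

lemma equiv_double_flip_equiv:
  assumes G: "pair_graph G"
  shows "equiv (Acyc G) (double_flip_equiv G)"
proof -
  have *: "\<beta> \<in> Acyc G \<and> (double_flip G)\<^sup>*\<^sup>* \<beta> \<alpha>"
    if "(double_flip G)\<^sup>*\<^sup>* \<alpha> \<beta>" "\<alpha> \<in> Acyc G" for \<alpha> \<beta>
    using that
    by (induction rule: rtranclp_induct)
      (auto dest: double_flip_Acyc[OF G] intro: converse_rtranclp_into_rtranclp)
  show ?thesis
    by (intro equivI refl_onI symI transI)
      (auto simp: double_flip_equiv_def dest: * intro: rtranclp_trans)
qed

lemma linear_extensions_nonempty:
  assumes G: "pair_graph G" "pverts G = {1..n}" and "\<alpha> \<in> Acyc G"
  shows "linear_extensions n \<alpha> \<noteq> {}"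
proof -
  interpret pair_graph G by fact
  define V where "V = {1..n}"
  define f where "f x = card {y \<in> V. (y, x) \<in> \<alpha>\<^sup>*}" for x
  define xs where "xs = sort_key f [1..<Suc n]"
  define \<sigma> where "\<sigma> = restrict (\<lambda>i. xs ! (i - 1)) V"
  have xs: "distinct xs" "set xs = V" "length xs = n" "sorted (map f xs)"
    unfolding xs_def V_def by (auto simp del: upt_Suc)
  have "bij_betw (\<lambda>i. i - 1) V {..<n}"
    by (rule bij_betwI[where g = Suc]) (auto simp: V_def)
  moreover have "bij_betw ((!) xs) {..<n} V"
    using bij_betw_nth[OF xs(1)] xs(2,3) by auto
  ultimately have "bij_betw (\<lambda>i. xs ! (i - 1)) V V"
    using bij_betw_trans[of "\<lambda>i. i - 1" V "{..<n}" "(!) xs" V] by (simp add: comp_def)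
  then have bij: "bij_betw \<sigma> V V"
    unfolding \<sigma>_def by (simp add: bij_betw_restrict_eq)
  have "inv_into V \<sigma> a \<le> inv_into V \<sigma> b" if "a \<in> V" "b \<in> V" "(a, b) \<in> \<alpha>\<^sup>*" for a b
  proof (rule ccontr)
    define i j where "i = inv_into V \<sigma> a" and "j = inv_into V \<sigma> b"
    assume "\<not> inv_into V \<sigma> a \<le> inv_into V \<sigma> b"
    then have ji: "j < i" by (simp add: i_def j_def)
    have ij: "i \<in> V" "j \<in> V" "\<sigma> i = a" "\<sigma> j = b"
      using that bij unfolding i_def j_def
      by (simp_all add: bij_betw_def inv_into_into f_inv_into_f)
    then have "xs ! (i - 1) = a" "xs ! (j - 1) = b" "i - 1 < n" "j - 1 \<le> i - 1"
      using ji by (auto simp: \<sigma>_def V_def)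
    then have "f b \<le> f a"
      using sorted_nth_mono[OF xs(4), of "j - 1" "i - 1"] xs(3) by simp
    moreover have "a \<noteq> b" using ij ji i_def j_def by auto
    then have "(b, a) \<notin> \<alpha>\<^sup>*"
      using that(3) assms(3) unfolding Acyc_def acyclic_def
      by (metis (mono_tags, lifting) mem_Collect_eq rtranclD trancl_rtrancl_trancl)
    then have "{y \<in> V. (y, a) \<in> \<alpha>\<^sup>*} \<subset> {y \<in> V. (y, b) \<in> \<alpha>\<^sup>*}"
      using that by (auto intro: rtrancl_trans)
    then have "f a < f b"
      unfolding f_def by (intro psubset_card_mono) (simp_all add: V_def)
    ultimately show False by simp
  qed
  then have "\<sigma> \<in> linear_extensions n \<alpha>"
    using bij by (auto simp: linear_extensions_def bijections_def orientation_le_def V_def \<sigma>_def)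
  then show ?thesis by blast
qed

end

theory Submission
  imports Defs "HOL-Combinatorics.Transposition"
begin

text \<open>
  Let \<open>G\<close> be the complement of \<open>Y\<close>. A bijection \<open>\<sigma>\<close> lists the vertices of \<open>G\<close> in a row, and orienting
  every edge of \<open>G\<close> from left to right gives an acyclic orientation \<open>\<alpha>\<^sub>\<sigma>\<close>. It is the only acyclic
  orientation that has \<open>\<sigma>\<close> as a linear extension (\<open>linear_extensions_iff\<close>), so the sets of linear
  extensions of the double-flip classes are the fibres of \<open>\<sigma> \<mapsto> [\<alpha>\<^sub>\<sigma>]\<close> and partition the bijections. It
  remains to see that these fibres are the connected components, that is, that \<open>\<sigma>\<close> and \<open>\<tau>\<close> are connected
  if and only if \<open>\<alpha>\<^sub>\<sigma>\<close> and \<open>\<alpha>\<^sub>\<tau>\<close> are double-flip equivalent (\<open>FS_cycle_reachable_iff\<close>).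

  A move swaps two entries that are cyclically adjacent and not adjacent in \<open>G\<close>. If the positions are \<open>i\<close>
  and \<open>i + 1\<close>, no other pair of entries changes its order, so \<open>\<alpha>\<^sub>\<sigma>\<close> stays the same. If they are the two
  ends of the row, the entries are a source and a sink of \<open>\<alpha>\<^sub>\<sigma>\<close>, and the move performs their double flip
  (\<open>FS_cycle_arc_imp_double_flip\<close>).

  Conversely, two rows with the same orientation are connected by bubble sort: as long as they differ, the
  first has two consecutive entries in the order opposite to that of the second; these cannot be adjacent
  in \<open>G\<close>, so swapping them is a move, and it reduces the number of inversions
  (\<open>same_orientation_reachable\<close>). To realise a double flip of a source \<open>u\<close> and a sink \<open>v\<close>, take a linear
  extension that begins with \<open>u\<close> and ends with \<open>v\<close>, and swap its ends (\<open>double_flip_realised\<close>).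
\<close>

section \<open>Orientations read off from an ordering\<close>

definition order_orientation :: "'a pair_pre_digraph \<Rightarrow> ('a \<Rightarrow> nat) \<Rightarrow> ('a \<times> 'a) set" where
  "order_orientation G p = {(a, b) \<in> parcs G. p a < p b}"

lemma in_order_orientation:
  "(a, b) \<in> order_orientation G p \<longleftrightarrow> (a, b) \<in> parcs G \<and> p a < p b"
  by (simp add: order_orientation_def)

text \<open>The value of \<open>p\<close> strictly increases along every arc, so there is no directed cycle.\<close>

lemma order_orientation_Acyc:
  assumes "pair_graph G" "inj_on p (pverts G)"
  shows "order_orientation G p \<in> Acyc G"
proof -
  interpret pair_graph G by fact
  have "p a < p b \<or> p b < p a" if "(a, b) \<in> parcs G" for a b
    using that assms(2) no_loops' in_arcsD1 in_arcsD2 by (metis inj_onD linorder_neqE_nat)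
  then have "orientation G (order_orientation G p)"
    using arcs_symmetric by (fastforce simp: orientation_def order_orientation_def)
  moreover have "acyclic (order_orientation G p)"
    by (rule acyclic_subset[OF wf_acyclic[OF wf_measure[of p]]])
      (auto simp: order_orientation_def)
  ultimately show ?thesis
    by (simp add: Acyc_def)
qed

text \<open>
  Among the two directions of an edge, the ordering of its ends by \<open>\<sigma>\<close> allows only one. Hence a
  linear extension determines the orientation that it extends.
\<close>

lemma linear_extensions_iff:
  assumes G: "pair_graph G" "pverts G = {1..n}" and \<alpha>: "\<alpha> \<in> Acyc G"
  shows "\<sigma> \<in> linear_extensions n \<alpha> \<longleftrightarrow>
    \<sigma> \<in> bijections {1..n} {1..n} \<and> order_orientation G (inv_into {1..n} \<sigma>) = \<alpha>"
    (is "?L \<longleftrightarrow> _ \<and> order_orientation G ?p = \<alpha>")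
proof -
  interpret pair_graph G by fact
  have or: "\<And>a b. (a, b) \<in> parcs G \<longleftrightarrow> (a, b) \<in> \<alpha> \<or> (b, a) \<in> \<alpha>"
    using \<alpha> by (auto simp: Acyc_def orientation_def)
  have V: "a \<in> {1..n} \<and> b \<in> {1..n} \<and> a \<noteq> b" if "(a, b) \<in> \<alpha>" for a b
    using that or in_arcsD1 in_arcsD2 no_loops' G(2) by blast
  have "order_orientation G ?p = \<alpha>" if ?L
  proof -
    have \<sigma>: "bij_betw \<sigma> {1..n} {1..n}"
      using that by (auto simp: linear_extensions_def bijections_def)
    have "?p a < ?p b" if ab: "(a, b) \<in> \<alpha>" for a b
    proof -
      have "?p a \<le> ?p b"
        using \<open>?L\<close> V[OF ab] ab by (auto simp: linear_extensions_def orientation_le_def)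
      moreover have "?p a \<noteq> ?p b"
        using V[OF ab] \<sigma> by (metis bij_betw_imp_surj_on inv_into_injective)
      ultimately show ?thesis by simp
    qed
    then have "(a, b) \<in> order_orientation G ?p \<longleftrightarrow> (a, b) \<in> \<alpha>" for a b
      unfolding in_order_orientation using or less_asym by blast
    then show ?thesis by auto
  qed
  moreover have ?L
    if \<sigma>: "\<sigma> \<in> bijections {1..n} {1..n}" and eq: "order_orientation G ?p = \<alpha>"
  proof -
    have "?p a \<le> ?p b" if "(a, b) \<in> \<alpha>\<^sup>*" for a b
      using that by induction (auto simp: eq[symmetric] in_order_orientation)
    with \<sigma> show ?thesis
      by (simp add: linear_extensions_def orientation_le_def)
  qed
  ultimately show ?thesis
    by (auto simp: linear_extensions_def)
qed

lemma transpose_Suc_less_iff: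
  fixes x y i :: nat
  assumes "\<not> (x = i \<and> y = Suc i)" "\<not> (x = Suc i \<and> y = i)"
  shows "transpose i (Suc i) x < transpose i (Suc i) y \<longleftrightarrow> x < y"
  using assms by (auto simp: transpose_def)

text \<open>
  Orderings are written as position functions \<open>p\<close>, so swapping the entries at two positions composes
  \<open>p\<close> with a transposition on the left. For neighbouring positions only the order of the two swapped
  entries changes, and these are not joined by an edge.
\<close>

lemma order_orientation_transpose_Suc:
  assumes "\<And>a b. p a = i \<Longrightarrow> p b = Suc i \<Longrightarrow> (a, b) \<notin> parcs G \<and> (b, a) \<notin> parcs G"
  shows "order_orientation G (transpose i (Suc i) \<circ> p) = order_orientation G p"
  using assms transpose_Suc_less_iff
  unfolding set_eq_iff split_paired_All in_order_orientation comp_def by metis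

text \<open>
  The first entry precedes all others and the last one follows all others; after the swap it is the other
  way round. So exactly the edges at these two vertices are reversed.
\<close>

lemma order_orientation_transpose_ends:
  assumes G: "pair_graph G" and inj: "inj_on p (pverts G)"
    and range: "p ` pverts G \<subseteq> {1..n}"
    and u: "u \<in> pverts G" "p u = 1" and v: "v \<in> pverts G" "p v = n"
  shows "order_orientation G (transpose 1 n \<circ> p) = reverse_at {u, v} (order_orientation G p)"
proof -
  interpret pair_graph G by fact
  have sym: "(a, b) \<in> parcs G \<longleftrightarrow> (b, a) \<in> parcs G" for a b
    using arcs_symmetric by blast
  have ends: "1 \<le> p a" "p a \<le> n" "p a = 1 \<longleftrightarrow> a = u" "p a = n \<longleftrightarrow> a = v"
    if "a \<in> pverts G" for a
    using that range u v inj by (auto simp: inj_on_def image_subset_iff)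
  have "(a, b) \<in> order_orientation G (transpose 1 n \<circ> p) \<longleftrightarrow>
        (a, b) \<in> reverse_at {u, v} (order_orientation G p)" for a b
  proof (cases "(a, b) \<in> parcs G")
    case True
    then have ab: "a \<in> pverts G" "b \<in> pverts G" "a \<noteq> b"
      using in_arcsD1 in_arcsD2 no_loops' by blast+
    show ?thesis
      using True sym[of a b] ab ends[OF ab(1)] ends[OF ab(2)]
      by (auto simp: in_order_orientation reverse_at_conv transpose_def)
  next
    case False
    then show ?thesis
      using sym[of a b] by (auto simp: in_order_orientation reverse_at_conv)
  qed
  then show ?thesis by auto
qed

section \<open>Moves in the friends-and-strangers graph of a cycle\<close>

lemma bijections_transpose:
  assumes "\<sigma> \<in> bijections A B" "i \<in> A" "j \<in> A"
  shows "\<sigma> \<circ> transpose i j \<in> bijections A B"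
proof -
  have "bij_betw (transpose i j) A A"
    using assms(2,3) by (intro bij_betwI[where g = "transpose i j"]) (auto simp: transpose_def)
  then have "bij_betw (\<sigma> \<circ> transpose i j) A B"
    using assms(1) by (auto simp: bijections_def intro: bij_betw_trans)
  moreover have "\<sigma> \<circ> transpose i j \<in> extensional A"
    using assms by (auto simp: bijections_def extensional_def transpose_def)
  ultimately show ?thesis
    by (simp add: bijections_def)
qed

lemma inv_into_transpose:
  assumes "\<sigma> \<in> bijections A B" "i \<in> A" "j \<in> A" "x \<in> B"
  shows "inv_into A (\<sigma> \<circ> transpose i j) x = transpose i j (inv_into A \<sigma> x)"
proof (rule inv_into_f_eq)
  show "inj_on (\<sigma> \<circ> transpose i j) A"
    using bijections_transpose[OF assms(1-3)] by (simp add: bijections_def bij_betw_def)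
  have "inv_into A \<sigma> x \<in> A"
    using assms by (auto simp: bijections_def bij_betw_def intro: inv_into_into)
  then show "transpose i j (inv_into A \<sigma> x) \<in> A"
    using assms by (auto simp: transpose_def)
  show "(\<sigma> \<circ> transpose i j) (transpose i j (inv_into A \<sigma> x)) = x"
    using assms by (simp add: bijections_def bij_betw_def f_inv_into_f)
qed

lemma order_orientation_comp_transpose:
  assumes G: "pair_graph G" "pverts G = B" and \<sigma>: "\<sigma> \<in> bijections A B" "i \<in> A" "j \<in> A"
  shows "order_orientation G (inv_into A (\<sigma> \<circ> transpose i j)) =
    order_orientation G (transpose i j \<circ> inv_into A \<sigma>)"
proof -
  interpret pair_graph G by fact
  show ?thesis
    using inv_into_transpose[OF \<sigma>] in_arcsD1 in_arcsD2 G(2)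
    by (auto simp: order_orientation_def)
qed

text \<open>
  Adjacency in terms of transpositions. The equality of functions on the right hand side is possible
  because bijections are extensional.
\<close>

lemma FS_arc_iff:
  assumes "pair_graph X" "\<sigma> \<in> bijections (pverts X) (pverts Y)"
  shows "(\<sigma>, \<tau>) \<in> parcs (FS X Y) \<longleftrightarrow>
    (\<exists>a b. (a, b) \<in> parcs X \<and> (\<sigma> a, \<sigma> b) \<in> parcs Y \<and> \<tau> = \<sigma> \<circ> transpose a b)"
proof -
  interpret pair_graph X by fact
  have "\<tau> = \<sigma> \<circ> transpose a b"
    if "\<tau> \<in> bijections (pverts X) (pverts Y)" "(a, b) \<in> parcs X" "\<sigma> a = \<tau> b" "\<sigma> b = \<tau> a"
      "\<forall>c \<in> pverts X - {a, b}. \<sigma> c = \<tau> c" for a b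
  proof
    fix c
    show "\<tau> c = (\<sigma> \<circ> transpose a b) c"
      using that assms(2) in_arcsD1[OF that(2)] in_arcsD2[OF that(2)]
      by (cases "c \<in> pverts X") (auto simp: transpose_def bijections_def extensional_def)
  qed
  moreover have "\<sigma> \<circ> transpose a b \<in> bijections (pverts X) (pverts Y)" if "(a, b) \<in> parcs X" for a b
    using bijections_transpose[OF assms(2)] in_arcsD1[OF that] in_arcsD2[OF that] .
  moreover have "\<sigma> a = (\<sigma> \<circ> transpose a b) b \<and> \<sigma> b = (\<sigma> \<circ> transpose a b) a \<and>
      (\<forall>c \<in> pverts X - {a, b}. \<sigma> c = (\<sigma> \<circ> transpose a b) c)" for a b
    by (simp add: transpose_def)
  moreover have "(\<sigma>, \<tau>) \<in> parcs (FS X Y) \<longleftrightarrow> \<tau> \<in> bijections (pverts X) (pverts Y) \<and>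
      (\<exists>a b. (a, b) \<in> parcs X \<and> (\<sigma> a, \<sigma> b) \<in> parcs Y \<and> \<sigma> a = \<tau> b \<and> \<sigma> b = \<tau> a \<and>
        (\<forall>c \<in> pverts X - {a, b}. \<sigma> c = \<tau> c))"
    using assms(2) by (simp add: FS_def)
  ultimately show ?thesis
    by metis
qed

text \<open>
  The arcs of the cycle come in both directions; by symmetry one direction is enough. For \<open>n = 2\<close> the two
  alternatives for \<open>(i, j)\<close> coincide.
\<close>

lemma FS_cycle_arc_iff:
  assumes n: "n \<ge> 2" and Y: "pair_graph Y" "pverts Y = {1..n}"
    and \<sigma>: "\<sigma> \<in> bijections {1..n} {1..n}"
  shows "(\<sigma>, \<tau>) \<in> parcs (FS (cycle_graph n) Y) \<longleftrightarrow>
    (\<exists>i j. (1 \<le> i \<and> i < n \<and> j = Suc i \<or> i = 1 \<and> j = n) \<and> (\<sigma> i, \<sigma> j) \<in> parcs Y \<and>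
      \<tau> = \<sigma> \<circ> transpose i j)"
proof -
  interpret pair_graph Y by fact
  have "pverts (cycle_graph n) = {1..n}"
    by (simp add: cycle_graph_def)
  then have *: "(\<sigma>, \<tau>) \<in> parcs (FS (cycle_graph n) Y) \<longleftrightarrow> (\<exists>a b. (a, b) \<in> parcs (cycle_graph n) \<and>
      (\<sigma> a, \<sigma> b) \<in> parcs Y \<and> \<tau> = \<sigma> \<circ> transpose a b)"
    using FS_arc_iff[OF pair_graph_cycle_graph[OF n], of \<sigma> Y \<tau>] \<sigma> Y by simp
  define C where "C a b \<longleftrightarrow> 1 \<le> a \<and> a < n \<and> b = Suc a \<or> a = 1 \<and> b = n" for a b
  define P where "P a b \<longleftrightarrow> (\<sigma> a, \<sigma> b) \<in> parcs Y \<and> \<tau> = \<sigma> \<circ> transpose a b" for a b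
  have cyc: "(a, b) \<in> parcs (cycle_graph n) \<longleftrightarrow> C a b \<or> C b a" for a b
    using n by (auto simp: cycle_graph_def Let_def C_def)
  have "P a b \<longleftrightarrow> P b a" for a b
    using arcs_symmetric by (auto simp: P_def transpose_commute)
  then have "(\<exists>a b. (C a b \<or> C b a) \<and> P a b) \<longleftrightarrow> (\<exists>a b. C a b \<and> P a b)"
    by blast
  then show ?thesis
    unfolding * cyc C_def P_def .
qed

lemma FS_cycle_arc_imp_double_flip:
  assumes n: "n \<ge> 2" and Y: "pair_graph Y" "pverts Y = {1..n}"
    and \<sigma>: "\<sigma> \<in> bijections {1..n} {1..n}" and arc: "(\<sigma>, \<tau>) \<in> parcs (FS (cycle_graph n) Y)"
  defines "G \<equiv> complement_graph Y"
  shows "order_orientation G (inv_into {1..n} \<tau>) = order_orientation G (inv_into {1..n} \<sigma>) \<or>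
    double_flip G (order_orientation G (inv_into {1..n} \<sigma>)) (order_orientation G (inv_into {1..n} \<tau>))"
proof -
  interpret Y: pair_graph Y by fact
  let ?p = "inv_into {1..n} \<sigma>"
  have G: "pair_graph G" "pverts G = {1..n}"
    using pair_graph_complement_graph[OF Y(1)] Y(2) by (auto simp: G_def complement_graph_def)
  interpret G: pair_graph G by fact
  have bij: "bij_betw \<sigma> {1..n} {1..n}"
    using \<sigma> by (simp add: bijections_def)
  then have pbij: "bij_betw ?p {1..n} {1..n}"
    by (rule bij_betw_inv_into)
  have p\<sigma>: "?p (\<sigma> k) = k" if "k \<in> {1..n}" for k
    using bij that by (rule bij_betw_inv_into_left)
  have \<sigma>p: "\<sigma> (?p a) = a" if "a \<in> {1..n}" for a
    using bij that by (rule bij_betw_inv_into_right)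
  obtain i j where ij: "1 \<le> i \<and> i < n \<and> j = Suc i \<or> i = 1 \<and> j = n" "(\<sigma> i, \<sigma> j) \<in> parcs Y"
      and \<tau>: "\<tau> = \<sigma> \<circ> transpose i j"
    using arc FS_cycle_arc_iff[OF n Y \<sigma>] by blast
  have ijV: "i \<in> {1..n}" "j \<in> {1..n}"
    using ij(1) n by auto
  have \<sigma>V: "\<sigma> i \<in> {1..n}" "\<sigma> j \<in> {1..n}"
    using ijV bij by (auto simp: bij_betw_def)
  have eq: "order_orientation G (inv_into {1..n} \<tau>) = order_orientation G (transpose i j \<circ> ?p)"
    unfolding \<tau> by (rule order_orientation_comp_transpose[OF G \<sigma> ijV])
  have nadj: "(\<sigma> i, \<sigma> j) \<notin> parcs G" "(\<sigma> j, \<sigma> i) \<notin> parcs G"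
    using ij(2) Y.arcs_symmetric by (auto simp: G_def complement_graph_def)
  show ?thesis
    \<comment> \<open>For \<open>n = 2\<close> the swap of the ends falls under the first case.\<close>
  proof (cases "j = Suc i")
    case True
    have "(a, b) \<notin> parcs G \<and> (b, a) \<notin> parcs G" if "?p a = i" "?p b = Suc i" for a b
      using that nadj \<sigma>p[of a] \<sigma>p[of b] True G(2) G.in_arcsD1 G.in_arcsD2 by metis
    then show ?thesis
      unfolding eq True by (intro disjI1 order_orientation_transpose_Suc) blast
  next
    case False
    then have ij1: "i = 1" "j = n" using ij by auto
    have *: "order_orientation G (transpose i j \<circ> ?p) =
        reverse_at {\<sigma> i, \<sigma> j} (order_orientation G ?p)"
      unfolding ij1 using pbij G \<sigma>V p\<sigma> ijV nadj(1) unfolding ij1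
      by (intro order_orientation_transpose_ends) (auto simp: bij_betw_def)
    have pr: "1 \<le> ?p a \<and> ?p a \<le> n" if "a \<in> pverts G" for a
      using pbij that G(2) by (auto simp: bij_betw_def)
    have p_ends: "?p (\<sigma> i) = 1" "?p (\<sigma> j) = n"
      using p\<sigma>[OF ijV(1)] p\<sigma>[OF ijV(2)] ij1 by simp_all
    have "(x, \<sigma> i) \<notin> order_orientation G ?p" for x
      using pr[of x] G.in_arcsD1[of x "\<sigma> i"] p_ends(1) by (auto simp: in_order_orientation)
    moreover have "(\<sigma> j, x) \<notin> order_orientation G ?p" for x
      using pr[of x] G.in_arcsD2[of "\<sigma> j" x] p_ends(2) by (auto simp: in_order_orientation)
    ultimately have "is_source (order_orientation G ?p) (\<sigma> i)" "is_sink (order_orientation G ?p) (\<sigma> j)"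
      by (simp_all add: is_source_def is_sink_def)
    then show ?thesis
      unfolding eq * double_flip_def using \<sigma>V[folded G(2)] nadj(1) by blast
  qed
qed

section \<open>Orderings with the same orientation\<close>

text \<open>
  Strict growth gives \<open>i \<le> g i\<close> starting from \<open>1 \<le> g 1\<close>, and \<open>g i \<le> i\<close> going down from \<open>g n \<le> n\<close>.
\<close>

lemma increasing_bij_id:
  fixes g :: "nat \<Rightarrow> nat"
  assumes g: "\<And>i. i \<in> {1..n} \<Longrightarrow> g i \<in> {1..n}"
    and inc: "\<And>i. 1 \<le> i \<Longrightarrow> i < n \<Longrightarrow> g i < g (Suc i)"
    and i: "i \<in> {1..n}"
  shows "g i = i"
proof (rule antisym)
  have le: "1 \<le> i" "i \<le> n" using i by auto
  from le(1) show "i \<le> g i"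
  proof (induction i rule: dec_induct)
    case base
    then show ?case using g[of 1] le by simp
  next
    case (step m)
    then show ?case using inc[of m] le by simp
  qed
  from le(2) show "g i \<le> i"
  proof (induction i rule: inc_induct)
    case base
    then show ?case using g[of n] le by simp
  next
    case (step m)
    then show ?case using inc[of m] le by simp
  qed
qed

text \<open>
  Bubble sort, by induction on the number of pairs that \<open>\<sigma>\<close> and \<open>\<tau>\<close> order differently. Two vertices that
  are adjacent in the complement of \<open>Y\<close> are ordered alike by \<open>\<sigma>\<close> and \<open>\<tau>\<close>, so a neighbouring pair that is
  ordered differently is an edge of \<open>Y\<close> and may be swapped.
\<close>

lemma same_orientation_reachable:
  assumes n: "n \<ge> 2" and Y: "pair_graph Y" "pverts Y = {1..n}"
    and \<sigma>: "\<sigma> \<in> bijections {1..n} {1..n}" and \<tau>: "\<tau> \<in> bijections {1..n} {1..n}"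
    and eq: "order_orientation (complement_graph Y) (inv_into {1..n} \<sigma>) =
      order_orientation (complement_graph Y) (inv_into {1..n} \<tau>)"
  shows "\<sigma> \<rightarrow>\<^sup>*\<^bsub>with_proj (FS (cycle_graph n) Y)\<^esub> \<tau>"
  using \<sigma> eq
proof (induction "card {(a, b) \<in> {1..n} \<times> {1..n}.
    inv_into {1..n} \<sigma> a < inv_into {1..n} \<sigma> b \<and> inv_into {1..n} \<tau> b < inv_into {1..n} \<tau> a}"
    arbitrary: \<sigma> rule: less_induct)
  case less
  interpret Y: pair_graph Y by fact
  define G where "G = complement_graph Y"
  have G: "pair_graph G" "pverts G = {1..n}"
    using pair_graph_complement_graph[OF Y(1)] Y(2) by (auto simp: G_def complement_graph_def)
  interpret G: pair_graph G by fact
  interpret F: pair_graph "FS (cycle_graph n) Y"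
    by (rule pair_graph_FS[OF pair_graph_cycle_graph[OF n] Y(1)])
  note \<sigma> = less.prems(1)
  define p q where "p = inv_into {1..n} \<sigma>" and "q = inv_into {1..n} \<tau>"
  have bij: "bij_betw \<sigma> {1..n} {1..n}" "bij_betw \<tau> {1..n} {1..n}"
    using \<sigma> \<tau> by (simp_all add: bijections_def)
  have pq: "bij_betw p {1..n} {1..n}" "bij_betw q {1..n} {1..n}"
    using bij by (simp_all add: p_def q_def bij_betw_inv_into)
  have p\<sigma>: "p (\<sigma> k) = k" and \<sigma>V: "\<sigma> k \<in> {1..n}" if "k \<in> {1..n}" for k
    using bij that bij_betw_inv_into_left[OF bij(1) that] by (auto simp: bij_betw_def p_def)
  have \<sigma>p: "\<sigma> (p a) = a" if "a \<in> {1..n}" for a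
    using bij_betw_inv_into_right[OF bij(1) that] by (simp add: p_def)
  show ?case
  proof (cases "\<forall>i. 1 \<le> i \<and> i < n \<longrightarrow> q (\<sigma> i) < q (\<sigma> (Suc i))")
    case True
    \<comment> \<open>Then \<open>q \<circ> \<sigma>\<close> increases from each position to the next, hence is the identity.\<close>
    have "\<sigma> i = \<tau> i" if i: "i \<in> {1..n}" for i
    proof -
      have "q (\<sigma> i) = i"
        by (rule increasing_bij_id[where g = "\<lambda>i. q (\<sigma> i)", OF _ _ i])
          (use True bij_betw_apply[OF pq(2)] \<sigma>V in auto)
      then show ?thesis
        using bij_betw_inv_into_right[OF bij(2) \<sigma>V[OF i]] by (simp add: q_def)
    qed
    then have "\<sigma> = \<tau>"
      using \<sigma> \<tau> by (intro extensionalityI[of _ "{1..n}"]) (auto simp: bijections_def)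
    moreover have "\<sigma> \<in> verts (with_proj (FS (cycle_graph n) Y))"
      using \<sigma> Y(2) by (simp add: FS_def cycle_graph_def)
    ultimately show ?thesis by simp
  next
    case False
    then obtain i where i: "1 \<le> i" "i < n" "\<not> q (\<sigma> i) < q (\<sigma> (Suc i))" by blast
    have iV: "i \<in> {1..n}" "Suc i \<in> {1..n}" using i by auto
    have ne: "\<sigma> i \<noteq> \<sigma> (Suc i)"
      using p\<sigma>[OF iV(1)] p\<sigma>[OF iV(2)] by auto
    then have desc: "q (\<sigma> (Suc i)) < q (\<sigma> i)"
      using i(3) \<sigma>V[OF iV(1)] \<sigma>V[OF iV(2)] pq(2)
      by (metis bij_betw_imp_inj_on inj_onD linorder_neqE_nat)
    have nadj: "(\<sigma> i, \<sigma> (Suc i)) \<notin> parcs G"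
    proof
      assume "(\<sigma> i, \<sigma> (Suc i)) \<in> parcs G"
      then have "(\<sigma> i, \<sigma> (Suc i)) \<in> order_orientation G p"
        using p\<sigma> iV by (simp add: in_order_orientation)
      then have "(\<sigma> i, \<sigma> (Suc i)) \<in> order_orientation G q"
        using less.prems(2) by (simp add: p_def q_def G_def)
      then show False
        using desc by (simp add: in_order_orientation)
    qed
    then have adj: "(\<sigma> i, \<sigma> (Suc i)) \<in> parcs Y"
      using ne \<sigma>V iV Y(2) by (auto simp: G_def complement_graph_def)
    define \<sigma>' where "\<sigma>' = \<sigma> \<circ> transpose i (Suc i)"
    have \<sigma>': "\<sigma>' \<in> bijections {1..n} {1..n}"
      unfolding \<sigma>'_def by (rule bijections_transpose[OF \<sigma> iV])
    have p': "inv_into {1..n} \<sigma>' a = transpose i (Suc i) (p a)" if "a \<in> {1..n}" for a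
      unfolding \<sigma>'_def p_def by (rule inv_into_transpose[OF \<sigma> iV that])
    have arc: "(\<sigma>, \<sigma>') \<in> parcs (FS (cycle_graph n) Y)"
      unfolding FS_cycle_arc_iff[OF n Y \<sigma>] \<sigma>'_def using i adj by blast
    have "order_orientation G (inv_into {1..n} \<sigma>') = order_orientation G (transpose i (Suc i) \<circ> p)"
      unfolding \<sigma>'_def p_def by (rule order_orientation_comp_transpose[OF G \<sigma> iV])
    also have "\<dots> = order_orientation G p"
    proof (rule order_orientation_transpose_Suc)
      fix a b assume "p a = i" "p b = Suc i"
      then show "(a, b) \<notin> parcs G \<and> (b, a) \<notin> parcs G"
        using nadj \<sigma>p[of a] \<sigma>p[of b] G(2) G.in_arcsD1 G.in_arcsD2 G.arcs_symmetric by metis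
    qed
    finally have eq': "order_orientation G (inv_into {1..n} \<sigma>') = order_orientation G q"
      using less.prems(2) by (simp add: p_def q_def G_def)
    let ?I = "\<lambda>p. {(a, b) \<in> {1..n} \<times> {1..n}. p a < p b \<and> q b < q a}"
    have "?I (inv_into {1..n} \<sigma>') \<subset> ?I p"
    proof
      have "p a < p b"
        if ab: "a \<in> {1..n}" "b \<in> {1..n}" "q b < q a"
          and "inv_into {1..n} \<sigma>' a < inv_into {1..n} \<sigma>' b" for a b
      proof -
        have lt: "transpose i (Suc i) (p a) < transpose i (Suc i) (p b)"
          using that p' by simp
        have "\<not> (p a = Suc i \<and> p b = i)"
          using \<sigma>p[OF ab(1)] \<sigma>p[OF ab(2)] desc ab(3) by auto
        moreover have "\<not> (p a = i \<and> p b = Suc i)"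
          using lt by auto
        ultimately show ?thesis
          using lt transpose_Suc_less_iff by blast
      qed
      then show "?I (inv_into {1..n} \<sigma>') \<subseteq> ?I p" by blast
      have "(\<sigma> i, \<sigma> (Suc i)) \<in> ?I p"
        using desc p\<sigma> \<sigma>V iV by simp
      moreover have "(\<sigma> i, \<sigma> (Suc i)) \<notin> ?I (inv_into {1..n} \<sigma>')"
        using p' p\<sigma> \<sigma>V iV by simp
      ultimately show "?I (inv_into {1..n} \<sigma>') \<noteq> ?I p" by blast
    qed
    then have "card (?I (inv_into {1..n} \<sigma>')) < card (?I p)"
      by (rule psubset_card_mono[rotated]) (rule finite_subset[of _ "{1..n} \<times> {1..n}"], auto)
    then have "\<sigma>' \<rightarrow>\<^sup>*\<^bsub>with_proj (FS (cycle_graph n) Y)\<^esub> \<tau>"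
      using less.hyps[of \<sigma>'] \<sigma>' eq' by (simp add: p_def q_def G_def)
    with arc show ?thesis
      by (rule F.adj_reachable_trans)
  qed
qed

section \<open>Realising double flips\<close>

text \<open>Turns an arbitrary injective sorting key into positions \<open>1, \<dots>, card V\<close>.\<close>

lemma rank_bij_betw:
  fixes f :: "'a \<Rightarrow> nat"
  assumes "finite V" "inj_on f V"
  defines "r \<equiv> \<lambda>x. card {y \<in> V. f y \<le> f x}"
  shows "bij_betw r V {1..card V}" "\<And>x y. x \<in> V \<Longrightarrow> y \<in> V \<Longrightarrow> r x < r y \<longleftrightarrow> f x < f y"
proof -
  have less: "r x < r y" if "x \<in> V" "y \<in> V" "f x < f y" for x y
  proof -
    have "{z \<in> V. f z \<le> f x} \<subseteq> {z \<in> V. f z \<le> f y}"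
      using that by auto
    moreover have "y \<in> {z \<in> V. f z \<le> f y} - {z \<in> V. f z \<le> f x}"
      using that by simp
    ultimately have "{z \<in> V. f z \<le> f x} \<subset> {z \<in> V. f z \<le> f y}"
      by blast
    then show ?thesis
      unfolding r_def using assms(1) by (intro psubset_card_mono) simp_all
  qed
  then show iff: "r x < r y \<longleftrightarrow> f x < f y" if "x \<in> V" "y \<in> V" for x y
    using that assms(2) by (metis inj_onD linorder_neqE_nat less_asym less_irrefl)
  have "inj_on r V"
    using iff assms(2) by (intro inj_onI) (metis inj_onD linorder_neqE_nat less_irrefl)
  moreover have "r ` V \<subseteq> {1..card V}"
  proof clarify
    fix x assume "x \<in> V"
    then have "0 < r x" "r x \<le> card V"
      unfolding r_def using assms(1) by (auto simp: card_gt_0_iff intro: card_mono)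
    then show "r x \<in> {1..card V}" by simp
  qed
  ultimately have "r ` V = {1..card V}"
    by (intro card_subset_eq) (simp_all add: card_image)
  with \<open>inj_on r V\<close> show "bij_betw r V {1..card V}"
    by (simp add: bij_betw_def)
qed

text \<open>
  In any linear extension a source can be moved to the front and a sink to the end without violating an
  arc: no arc enters the source, and none leaves the sink.
\<close>

lemma linear_extension_with_ends:
  assumes G: "pair_graph G" "pverts G = {1..n}" and \<alpha>: "\<alpha> \<in> Acyc G"
    and u: "u \<in> {1..n}" "is_source \<alpha> u" and v: "v \<in> {1..n}" "is_sink \<alpha> v" and "u \<noteq> v"
  obtains \<sigma> where "\<sigma> \<in> bijections {1..n} {1..n}" "order_orientation G (inv_into {1..n} \<sigma>) = \<alpha>"
    "\<sigma> 1 = u" "\<sigma> n = v"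
proof -
  interpret pair_graph G by fact
  let ?V = "{1..n}"
  obtain \<sigma>0 where "\<sigma>0 \<in> linear_extensions n \<alpha>"
    using linear_extensions_nonempty[OF G \<alpha>] by blast
  then have \<sigma>0: "bij_betw \<sigma>0 ?V ?V" "order_orientation G (inv_into ?V \<sigma>0) = \<alpha>"
    using linear_extensions_iff[OF G \<alpha>] by (auto simp: bijections_def)
  define p where "p = inv_into ?V \<sigma>0"
  have p: "bij_betw p ?V ?V"
    unfolding p_def using \<sigma>0(1) by (rule bij_betw_inv_into)
  then have p_range: "1 \<le> p x" "p x \<le> n" if "x \<in> ?V" for x
    using bij_betw_apply[OF p that] by auto
  have arc: "(x, y) \<in> \<alpha> \<longleftrightarrow> (x, y) \<in> parcs G \<and> p x < p y" for x y
    using \<sigma>0(2)[symmetric] by (simp add: in_order_orientation p_def)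
  \<comment> \<open>The positions in \<open>\<sigma>0\<close> lie in \<open>{1..n}\<close>, so the keys \<open>0\<close> and \<open>Suc n\<close> are extreme.\<close>
  define f where "f x = (if x = u then 0 else if x = v then Suc n else p x)" for x
  have inj: "inj_on f ?V"
  proof (rule inj_onI)
    fix x y assume "x \<in> ?V" "y \<in> ?V" "f x = f y"
    then show "x = y"
      using p_range[of x] p_range[of y] inj_onD[OF bij_betw_imp_inj_on[OF p], of x y]
      by (simp add: f_def split: if_splits)
  qed
  define r where "r x = card {y \<in> ?V. f y \<le> f x}" for x
  have r: "bij_betw r ?V ?V" "\<And>x y. x \<in> ?V \<Longrightarrow> y \<in> ?V \<Longrightarrow> r x < r y \<longleftrightarrow> f x < f y"
    using rank_bij_betw[OF _ inj] unfolding r_def by auto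
  define \<sigma> where "\<sigma> = restrict (inv_into ?V r) ?V"
  have \<sigma>: "bij_betw \<sigma> ?V ?V"
    unfolding \<sigma>_def using bij_betw_inv_into[OF r(1)] by (simp add: bij_betw_restrict_eq)
  have \<sigma>r: "\<sigma> (r x) = x" if "x \<in> ?V" for x
    using bij_betw_apply[OF r(1) that] bij_betw_inv_into_left[OF r(1) that] by (simp add: \<sigma>_def)
  have inv: "inv_into ?V \<sigma> x = r x" if "x \<in> ?V" for x
    by (rule inv_into_f_eq[OF bij_betw_imp_inj_on[OF \<sigma>] bij_betw_apply[OF r(1) that] \<sigma>r[OF that]])
  have "{y \<in> ?V. f y \<le> f u} = {u}"
    using u(1) p_range by (force simp: f_def)
  then have "r u = 1" by (simp add: r_def)
  have "{y \<in> ?V. f y \<le> f v} = ?V"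
    using p_range \<open>u \<noteq> v\<close> by (force simp: f_def)
  then have "r v = n" by (simp add: r_def)
  have "(x, y) \<in> order_orientation G (inv_into ?V \<sigma>) \<longleftrightarrow> (x, y) \<in> \<alpha>" for x y
  proof (cases "(x, y) \<in> parcs G")
    case True
    then have xy: "x \<in> ?V" "y \<in> ?V" "x \<noteq> y"
      using in_arcsD1 in_arcsD2 no_loops' G(2) by blast+
    have "p x \<noteq> p y"
      using xy bij_betw_imp_inj_on[OF p] by (meson inj_onD)
    moreover have "(y, x) \<in> parcs G" using True arcs_symmetric by blast
    moreover have "(a, u) \<notin> \<alpha>" "(v, a) \<notin> \<alpha>" for a
      using u(2) v(2) by (auto simp: is_source_def is_sink_def)
    ultimately have "f x < f y \<longleftrightarrow> p x < p y"
      using True xy p_range[OF xy(1)] p_range[OF xy(2)] \<open>u \<noteq> v\<close> arc[of x y] arc[of y x]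
      by (auto simp: f_def)
    then show ?thesis
      using True unfolding in_order_orientation arc inv[OF xy(1)] inv[OF xy(2)] r(2)[OF xy(1,2)]
      by simp
  next
    case False
    then show ?thesis by (simp add: in_order_orientation arc)
  qed
  then have "order_orientation G (inv_into ?V \<sigma>) = \<alpha>" by auto
  moreover have "\<sigma> \<in> bijections ?V ?V"
    using \<sigma> by (simp add: bijections_def \<sigma>_def)
  moreover have "\<sigma> 1 = u" "\<sigma> n = v"
    using \<sigma>r[OF u(1)] \<sigma>r[OF v(1)] \<open>r u = 1\<close> \<open>r v = n\<close> by simp_all
  ultimately show ?thesis using that by blast
qed

text \<open>
  A nontrivial double flip at \<open>u\<close> and \<open>v\<close> is the swap of the ends of a linear extension from \<open>u\<close> to \<open>v\<close>.
  This swap is a move because \<open>u\<close> and \<open>v\<close> are distinct and not adjacent in the complement of \<open>Y\<close>.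
\<close>

lemma double_flip_realised:
  assumes n: "n \<ge> 2" and Y: "pair_graph Y" "pverts Y = {1..n}"
  defines "G \<equiv> complement_graph Y"
  assumes \<alpha>: "\<alpha> \<in> Acyc G" and flip: "double_flip G \<alpha> \<beta>"
  obtains \<sigma> \<tau> where "\<sigma> \<in> linear_extensions n \<alpha>" "\<tau> \<in> linear_extensions n \<beta>"
    "\<sigma> \<rightarrow>\<^sup>*\<^bsub>with_proj (FS (cycle_graph n) Y)\<^esub> \<tau>"
proof -
  interpret Y: pair_graph Y by fact
  have G: "pair_graph G" "pverts G = {1..n}"
    using pair_graph_complement_graph[OF Y(1)] Y(2) by (auto simp: G_def complement_graph_def)
  interpret G: pair_graph G by fact
  interpret F: pair_graph "FS (cycle_graph n) Y"
    by (rule pair_graph_FS[OF pair_graph_cycle_graph[OF n] Y(1)])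
  have \<beta>: "\<beta> \<in> Acyc G"
    using double_flip_Acyc(1)[OF G(1) \<alpha> flip] .
  obtain u v where uv: "u \<in> {1..n}" "v \<in> {1..n}" "is_source \<alpha> u" "is_sink \<alpha> v" "(u, v) \<notin> parcs G"
      and \<beta>_eq: "\<beta> = reverse_at {u, v} \<alpha>"
    using flip G(2) by (auto simp: double_flip_def)
  show ?thesis
  proof (cases "u = v")
    case True
    \<comment> \<open>A vertex that is both source and sink has no arcs to reverse.\<close>
    then have "\<beta> = \<alpha>"
      using uv(3,4) by (auto simp: \<beta>_eq set_eq_iff reverse_at_conv is_source_def is_sink_def)
    moreover obtain \<sigma> where "\<sigma> \<in> linear_extensions n \<alpha>"
      using linear_extensions_nonempty[OF G \<alpha>] by blast
    moreover from this have "\<sigma> \<in> verts (with_proj (FS (cycle_graph n) Y))"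
      using Y(2) by (simp add: linear_extensions_def FS_def cycle_graph_def)
    ultimately show ?thesis
      using that[of \<sigma> \<sigma>] by simp
  next
    case False
    obtain \<sigma> where \<sigma>: "\<sigma> \<in> bijections {1..n} {1..n}"
        "order_orientation G (inv_into {1..n} \<sigma>) = \<alpha>" "\<sigma> 1 = u" "\<sigma> n = v"
      using linear_extension_with_ends[OF G \<alpha> uv(1,3) uv(2,4) False] by blast
    have V: "1 \<in> {1..n}" "n \<in> {1..n}" using n by auto
    define \<tau> where "\<tau> = \<sigma> \<circ> transpose 1 n"
    have bij: "bij_betw \<sigma> {1..n} {1..n}" using \<sigma>(1) by (simp add: bijections_def)
    have \<tau>: "\<tau> \<in> bijections {1..n} {1..n}"
      unfolding \<tau>_def by (rule bijections_transpose[OF \<sigma>(1) V])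
    have "order_orientation G (inv_into {1..n} \<tau>) =
        order_orientation G (transpose 1 n \<circ> inv_into {1..n} \<sigma>)"
      unfolding \<tau>_def by (rule order_orientation_comp_transpose[OF G \<sigma>(1) V])
    also have "\<dots> = \<beta>"
      unfolding \<beta>_eq \<sigma>(2)[symmetric]
      using bij_betw_inv_into[OF bij] uv G bij_betw_inv_into_left[OF bij V(1)]
        bij_betw_inv_into_left[OF bij V(2)] \<sigma>(3,4)
      by (intro order_orientation_transpose_ends) (auto simp: bij_betw_def)
    finally have "\<tau> \<in> linear_extensions n \<beta>"
      using linear_extensions_iff[OF G \<beta>] \<tau> by blast
    moreover have "\<sigma> \<in> linear_extensions n \<alpha>"
      using linear_extensions_iff[OF G \<alpha>] \<sigma> by blast
    moreover have "(\<sigma> 1, \<sigma> n) \<in> parcs Y"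
      using uv False \<sigma>(3,4) Y(2) by (auto simp: G_def complement_graph_def)
    then have "(\<sigma>, \<tau>) \<in> parcs (FS (cycle_graph n) Y)"
      using FS_cycle_arc_iff[OF n Y \<sigma>(1)] \<tau>_def by blast
    then have "\<sigma> \<rightarrow>\<^sup>*\<^bsub>with_proj (FS (cycle_graph n) Y)\<^esub> \<tau>"
      by (rule F.reachable_adjI)
    ultimately show ?thesis
      using that by blast
  qed
qed

section \<open>Components and double-flip classes\<close>

text \<open>
  A path of moves induces a sequence of double flips, one arc at a time. Conversely, each double flip of a
  sequence is realised by some pair of connected linear extensions, and consecutive pairs are linked
  because all linear extensions of one orientation are connected.
\<close>

lemma FS_cycle_reachable_iff:
  assumes n: "n \<ge> 2" and Y: "pair_graph Y" "pverts Y = {1..n}"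
    and \<sigma>: "\<sigma> \<in> bijections {1..n} {1..n}"
  defines "G \<equiv> complement_graph Y"
  shows "\<sigma> \<rightarrow>\<^sup>*\<^bsub>with_proj (FS (cycle_graph n) Y)\<^esub> \<tau> \<longleftrightarrow> \<tau> \<in> bijections {1..n} {1..n} \<and>
    (order_orientation G (inv_into {1..n} \<sigma>), order_orientation G (inv_into {1..n} \<tau>))
      \<in> double_flip_equiv G"
    (is "?reach \<sigma> \<tau> \<longleftrightarrow> _ \<and> (?or \<sigma>, ?or \<tau>) \<in> _")
proof -
  have G: "pair_graph G" "pverts G = {1..n}"
    using pair_graph_complement_graph[OF Y(1)] Y(2) by (auto simp: G_def complement_graph_def)
  interpret F: pair_graph "FS (cycle_graph n) Y"
    by (rule pair_graph_FS[OF pair_graph_cycle_graph[OF n] Y(1)])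
  have verts: "verts (with_proj (FS (cycle_graph n) Y)) = bijections {1..n} {1..n}"
    using Y(2) by (simp add: FS_def cycle_graph_def)
  have or_Acyc: "?or \<rho> \<in> Acyc G" if "\<rho> \<in> bijections {1..n} {1..n}" for \<rho>
    using that G order_orientation_Acyc[OF G(1)]
    by (simp add: bijections_def bij_betw_imp_inj_on[OF bij_betw_inv_into])
  have "\<tau> \<in> bijections {1..n} {1..n} \<and> (double_flip G)\<^sup>*\<^sup>* (?or \<sigma>) (?or \<tau>)" if "?reach \<sigma> \<tau>"
    using that
  proof (induction rule: F.reachable_induct)
    case base
    then show ?case using \<sigma> by simp
  next
    case (step \<rho> \<tau>)
    then have "(\<rho>, \<tau>) \<in> parcs (FS (cycle_graph n) Y)"
      by simp
    then have "\<tau> \<in> bijections {1..n} {1..n}"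
      using F.in_arcsD2 verts by simp
    moreover have "?or \<tau> = ?or \<rho> \<or> double_flip G (?or \<rho>) (?or \<tau>)"
      unfolding G_def using step.IH \<open>(\<rho>, \<tau>) \<in> _\<close>
      by (intro FS_cycle_arc_imp_double_flip[OF n Y]) auto
    ultimately show ?case
      using step.IH by (auto intro: rtranclp.rtrancl_into_rtrancl)
  qed
  moreover have "?reach \<sigma> \<tau>"
    if "(double_flip G)\<^sup>*\<^sup>* (?or \<sigma>) (?or \<tau>)" "\<tau> \<in> bijections {1..n} {1..n}"
  proof -
    have "\<beta> \<in> Acyc G \<and> (\<forall>\<tau> \<in> linear_extensions n \<beta>. ?reach \<sigma> \<tau>)"
      if "(double_flip G)\<^sup>*\<^sup>* (?or \<sigma>) \<beta>" for \<beta>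
      using that
    proof (induction rule: rtranclp_induct)
      case base
      then show ?case
        using same_orientation_reachable[OF n Y \<sigma>] linear_extensions_iff[OF G or_Acyc[OF \<sigma>]]
          or_Acyc[OF \<sigma>] by (auto simp: G_def)
    next
      case (step \<beta> \<gamma>)
      then have \<beta>: "\<beta> \<in> Acyc G" by simp
      then have \<gamma>: "\<gamma> \<in> Acyc G"
        using double_flip_Acyc(1)[OF G(1)] step by blast
      obtain \<rho> \<rho>' where \<rho>: "\<rho> \<in> linear_extensions n \<beta>" "\<rho>' \<in> linear_extensions n \<gamma>" "?reach \<rho> \<rho>'"
        using double_flip_realised[OF n Y] \<beta> step(2) unfolding G_def by blast
      have "?reach \<rho>' \<tau>" if "\<tau> \<in> linear_extensions n \<gamma>" for \<tau>
        using same_orientation_reachable[OF n Y] that \<rho>(2) linear_extensions_iff[OF G \<gamma>]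
        unfolding G_def by metis
      moreover have "?reach \<sigma> \<rho>'"
        using step.IH \<rho>(1) F.reachable_trans[OF _ \<rho>(3)] by simp
      ultimately have "?reach \<sigma> \<tau>" if "\<tau> \<in> linear_extensions n \<gamma>" for \<tau>
        using that F.reachable_trans by meson
      with \<gamma> show ?case by simp
    qed
    then show ?thesis
      using that linear_extensions_iff[OF G] by blast
  qed
  ultimately show ?thesis
    using or_Acyc[OF \<sigma>] by (auto simp: double_flip_equiv_def)
qed

lemma verts_component_of: "verts (component_of G x) = {y. x \<rightarrow>\<^sup>*\<^bsub>with_proj G\<^esub> y}"
  by (simp add: component_of_def)

lemma component_of_eq:
  assumes "pair_graph G" "x \<rightarrow>\<^sup>*\<^bsub>with_proj G\<^esub> y"
  shows "component_of G x = component_of G y"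
proof -
  interpret pair_graph G by fact
  have "{z. x \<rightarrow>\<^sup>*\<^bsub>with_proj G\<^esub> z} = {z. y \<rightarrow>\<^sup>*\<^bsub>with_proj G\<^esub> z}"
    using assms(2) reachable_trans symmetric_reachable[OF sym_arcs] by blast
  then show ?thesis by (simp add: component_of_def)
qed

text \<open>
  Once the vertex sets of the chosen components are known to partition the vertices, the arcs need no
  separate argument: both ends of an arc lie in the same component.
\<close>

lemma is_disjoint_union_components:
  assumes G: "pair_graph G"
    and disj: "disjoint_family_on (\<lambda>i. verts (component_of G (c i))) I"
    and cover: "(\<Union>i\<in>I. verts (component_of G (c i))) = pverts G"
  shows "is_disjoint_union (with_proj G) I (\<lambda>i. component_of G (c i))"
proof -
  interpret pair_graph G by fact
  have "subgraph (component_of G x) (with_proj G)" for x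
    unfolding component_of_def using reachable_in_verts(2)
    by (intro induced_imp_subgraph induced_induce) auto
  have "\<exists>i\<in>I. e \<in> arcs (component_of G (c i))" if e: "e \<in> parcs G" for e
  proof -
    have adj: "(fst e, snd e) \<in> parcs G" using e by simp
    then have "fst e \<in> pverts G" by (rule in_arcsD1)
    then obtain i where i: "i \<in> I" "c i \<rightarrow>\<^sup>*\<^bsub>with_proj G\<^esub> fst e"
      using cover by (auto simp: verts_component_of)
    have "c i \<rightarrow>\<^sup>*\<^bsub>with_proj G\<^esub> snd e"
      by (rule reachable_adj_trans[OF i(2) adj])
    then show ?thesis
      using i e by (intro bexI[of _ i]) (auto simp: component_of_def induce_subgraph_def)
  qed
  moreover have "arcs (component_of G x) \<subseteq> parcs G" for x
    by (auto simp: component_of_def induce_subgraph_def)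
  ultimately have "arcs (with_proj G) = (\<Union>i\<in>I. arcs (component_of G (c i)))"
    by (auto dest: subsetD)
  with \<open>\<And>x. subgraph (component_of G x) (with_proj G)\<close> show ?thesis
    using disj cover unfolding is_disjoint_union_def by simp
qed

theorem theorem4p1:
  fixes n :: nat
    and Y :: "nat pair_pre_digraph"
    and s :: "(nat \<times> nat) set set \<Rightarrow> (nat \<Rightarrow> nat)"
    and H :: "(nat \<times> nat) set set \<Rightarrow> (nat \<Rightarrow> nat, (nat \<Rightarrow> nat) \<times> (nat \<Rightarrow> nat)) pre_digraph"
  assumes "n \<ge> 2"
    and "pair_graph Y" and "pverts Y = {1..n}"
    and "\<And>A. A \<in> double_flip_classes (complement_graph Y) \<Longrightarrow> s A \<in> class_linear_extensions n A"
    and "\<And>A. A \<in> double_flip_classes (complement_graph Y) \<Longrightarrow>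
           H A = component_of (FS (cycle_graph n) Y) (s A)"
  shows "(\<forall>A \<in> double_flip_classes (complement_graph Y).
            (\<forall>\<tau> \<in> class_linear_extensions n A. component_of (FS (cycle_graph n) Y) \<tau> = H A) \<and>
            verts (H A) = class_linear_extensions n A) \<and>
         is_disjoint_union (with_proj (FS (cycle_graph n) Y))
           (double_flip_classes (complement_graph Y)) H"
proof -
  define G F where "G = complement_graph Y" and "F = FS (cycle_graph n) Y"
  note Y = assms(2,3)
  note defs = G_def[symmetric] F_def[symmetric]
  have G: "pair_graph G" "pverts G = {1..n}"
    using pair_graph_complement_graph[OF Y(1)] Y(2) by (auto simp: G_def complement_graph_def)
  have F: "pair_graph F"
    unfolding F_def by (rule pair_graph_FS[OF pair_graph_cycle_graph[OF assms(1)] Y(1)])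
  have vertsF: "pverts F = bijections {1..n} {1..n}"
    using Y(2) by (simp add: F_def FS_def cycle_graph_def)
  let ?C = "double_flip_classes G" and ?or = "\<lambda>\<sigma>. order_orientation G (inv_into {1..n} \<sigma>)"
  have equiv: "equiv (Acyc G) (double_flip_equiv G)"
    by (rule equiv_double_flip_equiv[OF G(1)])
  have or_Acyc: "?or \<sigma> \<in> Acyc G" if "\<sigma> \<in> bijections {1..n} {1..n}" for \<sigma>
    using that G order_orientation_Acyc[OF G(1)]
    by (simp add: bijections_def bij_betw_imp_inj_on[OF bij_betw_inv_into])
  have ext_iff: "\<sigma> \<in> class_linear_extensions n A \<longleftrightarrow>
      \<sigma> \<in> bijections {1..n} {1..n} \<and> ?or \<sigma> \<in> A" if "A \<in> ?C" for A \<sigma>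
  proof -
    have "A \<subseteq> Acyc G"
      using that in_quotient_imp_subset[OF equiv] by (simp add: double_flip_classes_def)
    then show ?thesis
      using linear_extensions_iff[OF G] by (auto simp: class_linear_extensions_def)
  qed
  have verts: "verts (component_of F \<sigma>) = class_linear_extensions n A"
    if A: "A \<in> ?C" and \<sigma>: "\<sigma> \<in> class_linear_extensions n A" for A \<sigma>
  proof -
    have "\<sigma> \<in> bijections {1..n} {1..n}" "?or \<sigma> \<in> A"
      using \<sigma> ext_iff[OF A] by auto
    moreover from this have "(?or \<sigma>, \<beta>) \<in> double_flip_equiv G \<longleftrightarrow> \<beta> \<in> A" for \<beta>
      using A in_quotient_imp_closed[OF equiv] in_quotient_imp_in_rel[OF equiv]
      unfolding double_flip_classes_def by blast
    ultimately show ?thesis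
      using FS_cycle_reachable_iff[OF assms(1) Y] ext_iff[OF A]
      by (auto simp: verts_component_of defs)
  qed
  have connected: "component_of F \<tau> = component_of F (s A)"
    if A: "A \<in> ?C" and \<tau>: "\<tau> \<in> class_linear_extensions n A" for A \<tau>
  proof -
    have "\<tau> \<in> verts (component_of F (s A))"
      using verts[OF A assms(4)[folded G_def, OF A]] \<tau> by simp
    then show ?thesis
      using component_of_eq[OF F, of "s A" \<tau>] by (simp add: verts_component_of)
  qed
  have "is_disjoint_union (with_proj F) ?C (\<lambda>A. component_of F (s A))"
  proof (rule is_disjoint_union_components[OF F])
    show "disjoint_family_on (\<lambda>A. verts (component_of F (s A))) ?C"
      unfolding disjoint_family_on_def
    proof (intro ballI impI)
      fix A B assume AB: "A \<in> ?C" "B \<in> ?C" "A \<noteq> B"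
      then have "A \<inter> B = {}"
        using quotient_disj[OF equiv] by (auto simp: double_flip_classes_def)
      then show "verts (component_of F (s A)) \<inter> verts (component_of F (s B)) = {}"
        using AB verts assms(4)[folded G_def F_def] ext_iff by blast
    qed
    have "\<exists>A\<in>?C. \<sigma> \<in> class_linear_extensions n A" if "\<sigma> \<in> bijections {1..n} {1..n}" for \<sigma>
      using or_Acyc[OF that] that ext_iff Union_quotient[OF equiv]
      unfolding double_flip_classes_def by blast
    then show "(\<Union>A\<in>?C. verts (component_of F (s A))) = pverts F"
      using verts assms(4)[folded G_def F_def] ext_iff vertsF by auto
  qed
  moreover have H: "H A = component_of F (s A)" if "A \<in> ?C" for A
    using assms(5) that unfolding G_def F_def .
  ultimately have "is_disjoint_union (with_proj F) ?C H"
    by (simp add: is_disjoint_union_def disjoint_family_on_def)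
  moreover have "verts (H A) = class_linear_extensions n A" if "A \<in> ?C" for A
    unfolding H[OF that] by (rule verts[OF that assms(4)[folded G_def, OF that]])
  moreover have "component_of F \<tau> = H A"
    if "A \<in> ?C" "\<tau> \<in> class_linear_extensions n A" for A \<tau>
    unfolding H[OF that(1)] by (rule connected[OF that])
  ultimately show ?thesis
    unfolding defs by blast
qed

end
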